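(* Let $H$ be a finite simple graph whose edges are colored red and blue. Let $P$ be a maximum packing in $\mathcal F(H)$ and let $Q$ be a maximum packing in $\mathcal F_P$. Put $p=|P|$ and $q=|Q|$, and let $u$ be the number of members of $P$ whose red edge is private in $\mathcal F(H)$. Then $$\tau(\mathcal F(H))\le\tfrac83\,p-\tfrac23\,u$$ and $$\tau(\mathcal F(H))\le\tfrac94\,p+\tfrac32\,q-\tfrac14\,u.$$
   Context: Graphs are finite and simple, and a triangle is identified with its set of three edges. For a family of triangles, a packing is a set of pairwise edge-disjoint members of the family; a maximum packing is one of largest size. A transversal of a family of triangles is a set of edges containing at least one edge of every member, and $\tau$ of a family denotes the minimum size of a transversal of it. For a graph $H$ whose edges are each colored red or blue, $\mathcal F(H)$ denotes the family of all triangles of $H$ with exactly one red edge (and hence two blue edges). For a packing $P$ in $\mathcal F(H)$, $B(P)$ denotes the set of blue edges of the members of $P$. $H-X$ denotes $H$ with the edge set $X$ deleted (keeping the coloring of the remaining edges), and $\mathcal F_P=\mathcal F(H-B(P))$. An edge is private in a family of triangles if exactly one member of the family contains it. *)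

theory Defs
  imports Complex_Main
begin

definition simple_graph :: "'a set \<Rightarrow> 'a set set \<Rightarrow> bool" where
  "simple_graph V E \<longleftrightarrow> finite V \<and> (\<forall>e\<in>E. e \<subseteq> V \<and> card e = 2)"

datatype colour = Red | Blue

text \<open>
  A coloured graph \<open>H\<close> is given by its vertex set \<open>V\<close>, its edge set \<open>E\<close> and a colouring \<open>c\<close>.
  The colouring is a total function, but only its values on \<open>E\<close> are ever used; hence \<open>H - X\<close>,
  with the inherited colouring, is given by \<open>V\<close>, \<open>E - X\<close> and the same \<open>c\<close>.
\<close>

definition triangles :: "'a set set \<Rightarrow> 'a set set set" where
  "triangles E = {T. T \<subseteq> E \<and>
     (\<exists>x y z. x \<noteq> y \<and> y \<noteq> z \<and> x \<noteq> z \<and> T = {{x, y}, {y, z}, {x, z}})}"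

definition one_red_triangles :: "'a set set \<Rightarrow> ('a set \<Rightarrow> colour) \<Rightarrow> 'a set set set" where
  "one_red_triangles E c = {T \<in> triangles E. card {e \<in> T. c e = Red} = 1}"

definition packing :: "'a set set set \<Rightarrow> 'a set set set \<Rightarrow> bool" where
  "packing F P \<longleftrightarrow> P \<subseteq> F \<and> pairwise disjnt P"

definition maximum_packing :: "'a set set set \<Rightarrow> 'a set set set \<Rightarrow> bool" where
  "maximum_packing F P \<longleftrightarrow> packing F P \<and> (\<forall>P'. packing F P' \<longrightarrow> card P' \<le> card P)"

definition transversal :: "'a set set \<Rightarrow> 'a set set set \<Rightarrow> 'a set set \<Rightarrow> bool" where
  "transversal E F X \<longleftrightarrow> X \<subseteq> E \<and> (\<forall>T\<in>F. X \<inter> T \<noteq> {})"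

text \<open>
  The ambient edge set \<open>E\<close> is an argument so that transversals range over sets of edges of the
  graph. For finite \<open>E\<close> and a family of triangles of \<open>E\<close>, the set \<open>E\<close> itself is a transversal,
  so the minimum exists.
\<close>

definition tau :: "'a set set \<Rightarrow> 'a set set set \<Rightarrow> nat" where
  "tau E F = (LEAST n. \<exists>X. transversal E F X \<and> card X = n)"

definition blue_edges :: "('a set \<Rightarrow> colour) \<Rightarrow> 'a set set set \<Rightarrow> 'a set set" where
  "blue_edges c P = {e \<in> \<Union>P. c e = Blue}"

definition private_edge :: "'a set set set \<Rightarrow> 'a set \<Rightarrow> bool" where
  "private_edge F e \<longleftrightarrow> (\<exists>!T. T \<in> F \<and> e \<in> T)"

end

theory Submission
  imports Defs
begin

text \<open>
  Let \<open>u'\<close> be the number of members of \<open>Q\<close> whose red edge is private in \<open>\<F>\<^sub>P\<close>. Three bounds are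
  combined: \<open>\<tau>(\<F>) \<le> 3p - u\<close> (for a member of \<open>P\<close> with private red edge its two blue edges suffice),
  \<open>\<tau>(\<F>) \<le> 2p + \<tau>(\<F>\<^sub>P)\<close>, and \<open>\<tau>(\<F>) \<le> 3p - u - 2q + u'\<close>. For the last one, every \<open>S \<in> Q\<close> shares its
  red edge with a member \<open>T\<close> of \<open>P\<close>, and exchanging any set of such \<open>T\<close> for the corresponding \<open>S\<close>
  again gives a maximum packing. Hence a triangle that avoids the shared red edges and the rest of
  \<open>P\<close> must meet both \<open>T\<close> and \<open>S\<close> in blue edges, for a single pair, which determines its red edge;
  and if the red edge of \<open>S\<close> lies in a further triangle of \<open>\<F>\<^sub>P\<close>, exchanging \<open>T\<close> for that triangle
  excludes this possibility too. So a pair costs two edges or one instead of three.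

  Adding two thirds of the last bound to one third of \<open>\<tau>(\<F>) \<le> 2p + 3q - u'\<close> gives the first
  inequality. Adding one quarter of the last bound to three quarters of \<open>\<tau>(\<F>) \<le> 2p + \<tau>(\<F>\<^sub>P)\<close>, with
  \<open>\<tau>(\<F>\<^sub>P)\<close> bounded by the first inequality for \<open>Q\<close>, gives the second.
\<close>

section \<open>Incidence of edges in triangles\<close>

lemma finite_edges: "simple_graph V E \<Longrightarrow> finite E"
  unfolding simple_graph_def by (rule finite_subset[of _ "Pow V"]) auto

lemma trianglesE:
  assumes "T \<in> triangles E"
  obtains x y z where "x \<noteq> y" "y \<noteq> z" "x \<noteq> z" "T = {{x, y}, {y, z}, {x, z}}"
  using assms unfolding triangles_def by (elim CollectE conjE exE)

lemma triangle_apex: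
  assumes "T \<in> triangles E" "e \<in> T"
  obtains x y z where "e = {x, y}" "x \<noteq> y" "z \<noteq> x" "z \<noteq> y" "T = {{x, y}, {x, z}, {y, z}}"
proof -
  obtain i j k where ijk: "i \<noteq> j" "j \<noteq> k" "i \<noteq> k" "T = {{i,j},{j,k},{i,k}}"
    using assms(1) by (rule trianglesE)
  consider "e = {i,j}" | "e = {j,k}" | "e = {i,k}" using assms(2) unfolding ijk(4) by auto
  then show ?thesis
  proof cases
    case 1
    have "T = {{i,j},{i,k},{j,k}}" unfolding ijk(4) by (simp only: insert_commute)
    then show ?thesis using that[OF \<open>e = {i,j}\<close>] ijk(1-3) by metis
  next
    case 2
    have "T = {{j,k},{j,i},{k,i}}" unfolding ijk(4) by (simp only: insert_commute)
    then show ?thesis using that[OF \<open>e = {j,k}\<close>] ijk(1-3) by metis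
  next
    case 3
    have "T = {{i,k},{i,j},{k,j}}" unfolding ijk(4) by (simp only: insert_commute)
    then show ?thesis using that[OF \<open>e = {i,k}\<close>] ijk(1-3) by metis
  qed
qed

text \<open>Two edges of a triangle share exactly one vertex, so the third edge is their symmetric
  difference. Hence two edges determine the triangle.\<close>

lemma triangle_eq:
  assumes "T \<in> triangles E" "a \<in> T" "b \<in> T" "a \<noteq> b"
  shows "T = {a, b, (a \<union> b) - (a \<inter> b)}"
proof -
  obtain x y z where T: "a = {x,y}" "x \<noteq> y" "z \<noteq> x" "z \<noteq> y" "T = {{x,y},{x,z},{y,z}}"
    using triangle_apex[OF assms(1,2)] .
  then have "b = {x,z} \<and> (a \<union> b) - (a \<inter> b) = {y,z} \<or> b = {y,z} \<and> (a \<union> b) - (a \<inter> b) = {x,z}"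
    using assms(3,4) by auto
  then show ?thesis using T(1,5) by (elim disjE conjE) (simp_all add: insert_commute)
qed

lemma triangles_eqI:
  assumes "T \<in> triangles E" "S \<in> triangles E'" "a \<in> T" "a \<in> S" "b \<in> T" "b \<in> S" "a \<noteq> b"
  shows "T = S"
  using triangle_eq[OF assms(1,3,5,7)] triangle_eq[OF assms(2,4,6,7)] by simp

text \<open>The set in the conclusion joins the apexes of \<open>T\<close> and \<open>S\<close>
  opposite their common edge \<open>r\<close>. The edges \<open>a\<close> and \<open>b\<close> of
  \<open>Y\<close> each end in one of these apexes; being edges of one triangle they meet,
  necessarily in an endpoint of \<open>r\<close>, so the remaining edge of \<open>Y\<close> joins
  the apexes.\<close>

lemma third_edge_between_triangles:
  assumes "T \<in> triangles E" "S \<in> triangles E'" "Y \<in> triangles E''" "r \<in> T" "r \<in> S" "T \<noteq> S"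
    and "a \<in> T" "a \<in> Y" "a \<noteq> r" "b \<in> S" "b \<in> Y" "b \<noteq> r"
  shows "(\<Union>T \<union> \<Union>S) - (\<Union>T \<inter> \<Union>S) \<in> Y"
proof -
  obtain x y z where r: "r = {x,y}" "x \<noteq> y" 
    and T: "z \<noteq> x" "z \<noteq> y" "T = {{x,y},{x,z},{y,z}}"
    using triangle_apex[OF assms(1,4)] by metis
  obtain x' y' w where S': "r = {x',y'}" "w \<noteq> x'" "w \<noteq> y'" "S = {{x',y'},{x',w},{y',w}}"
    using triangle_apex[OF assms(2,5)] by metis
  have "x' = x \<and> y' = y \<or> x' = y \<and> y' = x" using r(1) S'(1) by (simp add: doubleton_eq_iff)
  then have S: "w \<noteq> x" "w \<noteq> y" "S = {{x,y},{x,w},{y,w}}" using S' by (auto simp: insert_commute)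
  have zw: "z \<noteq> w" using \<open>T \<noteq> S\<close> T S by blast
  have ends: "(\<Union>T \<union> \<Union>S) - (\<Union>T \<inter> \<Union>S) = {z,w}"
    using T S zw by auto
  have a: "a = {x,z} \<or> a = {y,z}" using assms(7,9) T r by simp
  have b: "b = {x,w} \<or> b = {y,w}" using assms(10,12) S r by simp
  have ab: "a \<noteq> b"
  proof -
    have "z \<in> a" using a by blast
    moreover have "z \<notin> b" using b zw T(1,2) by blast
    ultimately show ?thesis by blast
  qed
  have "a \<inter> b \<noteq> {}"
  proof -
    obtain i j k where "Y = {{i,j},{j,k},{i,k}}"
      using assms(3) by (rule trianglesE)
    then show ?thesis using assms(8,11) by auto
  qed
  then have "(a \<union> b) - (a \<inter> b) = {z,w}"
    using a b zw T(1,2) S(1,2) r(2) by (elim disjE) auto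
  then show ?thesis
    unfolding ends using triangle_eq[OF assms(3,8,11) ab] by simp
qed

section \<open>Triangles with exactly one red edge\<close>

lemma one_red_trianglesE:
  assumes "T \<in> one_red_triangles E c"
  obtains r a b where "T = {r, a, b}" "r \<noteq> a" "r \<noteq> b" "a \<noteq> b"
    "c r = Red" "c a = Blue" "c b = Blue"
proof -
  obtain x y z where xyz: "x \<noteq> y" "y \<noteq> z" "x \<noteq> z" "T = {{x,y},{y,z},{x,z}}"
    using assms unfolding one_red_triangles_def by (elim CollectE conjE trianglesE)
  obtain r where r: "{e \<in> T. c e = Red} = {r}"
    using assms unfolding one_red_triangles_def by (auto simp: card_1_singleton_iff)
  have "card T = 3" using xyz by (auto simp: doubleton_eq_iff)
  then have "card (T - {r}) = 2" using r by (subst card_Diff_singleton) auto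
  then obtain a b where ab: "T - {r} = {a,b}" "a \<noteq> b" by (auto simp: card_2_iff)
  have "c e = Blue" if "e \<in> T - {r}" for e using that r by (cases "c e") auto
  then show ?thesis using that[of r a b] ab r by blast
qed

lemma card_one_red_triangle:
  assumes "T \<in> one_red_triangles E c"
  shows "finite T" "card T = 3" "card {e \<in> T. c e = Red} = 1" "card {e \<in> T. c e = Blue} = 2"
proof -
  obtain r a b where T: "T = {r, a, b}" "r \<noteq> a" "r \<noteq> b" "a \<noteq> b" "c r = Red" "c a = Blue" "c b = Blue"
    using one_red_trianglesE[OF assms] by metis
  then have "{e \<in> T. c e = Red} = {r}" "{e \<in> T. c e = Blue} = {a,b}" by auto
  then show "finite T" "card T = 3" "card {e \<in> T. c e = Red} = 1" "card {e \<in> T. c e = Blue} = 2" 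
    using T by auto
qed

lemma one_red_triangle_red_unique:
  assumes "T \<in> one_red_triangles E c" "e \<in> T" "e' \<in> T" "c e = Red" "c e' = Red"
  shows "e = e'"
proof -
  obtain r a b where "T = {r, a, b}" "c r = Red" "c a = Blue" "c b = Blue"
    using one_red_trianglesE[OF assms(1)] by metis
  then show ?thesis using assms(2-) by auto
qed

lemma one_red_triangle_blue:
  assumes "T \<in> one_red_triangles E c"
  shows "\<exists>b\<in>T. c b = Blue"
  by (rule one_red_trianglesE[OF assms]) simp

lemma one_red_triangles_subset_triangles: "one_red_triangles E c \<subseteq> triangles E"
  unfolding one_red_triangles_def by blast

lemma one_red_triangles_Diff:
  "one_red_triangles (E - X) c = {T \<in> one_red_triangles E c. T \<inter> X = {}}"
  unfolding one_red_triangles_def triangles_def by blast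

lemma finite_one_red_triangles: "finite E \<Longrightarrow> finite (one_red_triangles E c)"
  by (rule finite_subset[of _ "Pow E"]) (auto simp: one_red_triangles_def triangles_def)

section \<open>Minimum transversals and maximum packings\<close>

lemma tau_le: 
  assumes "transversal E F X" "card X \<le> n"
  shows "tau E F \<le> n"
  unfolding tau_def by (rule order_trans[OF Least_le[of _ "card X"]]) (use assms in blast)+

lemma tau_attained:
  assumes "F \<subseteq> triangles E"
  obtains X where "transversal E F X" "card X = tau E F"
proof -
  have "E \<inter> T \<noteq> {}" if "T \<in> F" for T
    using that assms unfolding triangles_def by auto
  then have "transversal E F E" unfolding transversal_def by blast
  then have "\<exists>n X. transversal E F X \<and> card X = n" by blast
  from LeastI_ex[OF this] show ?thesis using that unfolding tau_def by blast
qed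

text \<open>Otherwise \<open>insert Y P'\<close> would be a larger packing. A second packing
  \<open>P'\<close> is allowed so that the lemma applies after an exchange of members of
  \<open>P\<close>.\<close>

lemma maximum_packing_meets:
  assumes "maximum_packing F P" "finite P" "P' \<subseteq> F" "pairwise disjnt P'" "finite P'" "card P \<le> card P'"
    and "Y \<in> F" "Y \<noteq> {}"
  shows "\<exists>T\<in>P'. Y \<inter> T \<noteq> {}"
proof (rule ccontr)
  assume *: "\<not> ?thesis"
  with \<open>Y \<noteq> {}\<close> have "Y \<notin> P'" by blast
  have "packing F (insert Y P')"
    using assms * unfolding packing_def pairwise_insert by (auto simp: disjnt_def)
  then have "card (insert Y P') \<le> card P" using assms(1) unfolding maximum_packing_def by blast
  with \<open>Y \<notin> P'\<close> assms show False by simp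
qed

lemma maximum_packing_exists:
  assumes "finite F"
  shows "\<exists>P. maximum_packing F P"
proof -
  have "\<forall>P. packing F P \<longrightarrow> card P < Suc (card F)"
    using assms by (auto simp: packing_def less_Suc_eq_le intro: card_mono)
  moreover have "packing F {}" by (simp add: packing_def)
  ultimately show ?thesis
    unfolding maximum_packing_def using ex_has_greatest_nat[of "packing F" "{}" card "Suc (card F)"] by simp
qed

lemma maximum_packing_facts:
  assumes "finite E" "maximum_packing (one_red_triangles E c) P"
  shows "finite P" "P \<subseteq> one_red_triangles E c" "pairwise disjnt P"
    "\<And>Y. Y \<in> one_red_triangles E c \<Longrightarrow> \<exists>T\<in>P. Y \<inter> T \<noteq> {}"
proof -
  show *: "P \<subseteq> one_red_triangles E c" "pairwise disjnt P"
    using assms(2) unfolding maximum_packing_def packing_def by auto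
  show fin: "finite P" using * finite_subset finite_one_red_triangles[OF assms(1)] by metis
  show "\<exists>T\<in>P. Y \<inter> T \<noteq> {}" if "Y \<in> one_red_triangles E c" for Y
    using maximum_packing_meets[OF assms(2) fin * fin order_refl that] one_red_triangle_blue[OF that] 
    by blast
qed

section \<open>Bounds from private red edges and from deleting blue edges\<close>

definition red_private :: "('a set \<Rightarrow> colour) \<Rightarrow> 'a set set set \<Rightarrow> 'a set set \<Rightarrow> bool" where
  "red_private c F T \<longleftrightarrow> (\<exists>e\<in>T. c e = Red \<and> private_edge F e)"

lemma red_private_eq:
  assumes "red_private c (one_red_triangles E c) T" "T \<in> one_red_triangles E c" 
    "Y \<in> one_red_triangles E c" "e \<in> T" "e \<in> Y" "c e = Red"
  shows "Y = T"
  using assms one_red_triangle_red_unique[OF assms(2)] 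
  unfolding red_private_def private_edge_def by metis

lemma card_UN_le_mult:
  assumes "finite I" "\<And>i. i \<in> I \<Longrightarrow> card (A i) \<le> k"
  shows "card (\<Union>i\<in>I. A i) \<le> k * card I"
  using card_UN_le[OF assms(1), of A] sum_bounded_above[of I "\<lambda>i. card (A i)" k] assms(2)
  by (simp add: mult.commute)

text \<open>By maximality every triangle shares an edge with some \<open>T\<close> in
  \<open>P\<close>. If that edge is the private red edge of \<open>T\<close>, the triangle is
  \<open>T\<close> itself and is hit by a blue edge of \<open>T\<close>.\<close>

lemma tau_le_private:
  assumes "finite E" "maximum_packing (one_red_triangles E c) P"
  shows "tau E (one_red_triangles E c) + card {T \<in> P. red_private c (one_red_triangles E c) T} 
    \<le> 3 * card P"
proof -
  let ?F = "one_red_triangles E c"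
  define U where "U = {T \<in> P. red_private c ?F T}"
  note P = maximum_packing_facts[OF assms]
  have U: "U \<subseteq> P" "finite U" using P(1) unfolding U_def by auto
  define X where "X = (\<Union>T\<in>U. {e\<in>T. c e = Blue}) \<union> (\<Union>T\<in>P-U. T)"
  have "transversal E ?F X" unfolding transversal_def
  proof (intro conjI ballI)
    show "X \<subseteq> E" using P(2) U one_red_triangles_subset_triangles[of E c] 
      unfolding X_def triangles_def by blast
  next
    fix Y assume Y: "Y \<in> ?F"
    obtain T e where T: "T \<in> P" "e \<in> T" "e \<in> Y" using P(4)[OF Y] by blast
    show "X \<inter> Y \<noteq> {}"
    proof (cases "T \<in> U \<and> c e = Red")
      case True
      then have "Y = T" using red_private_eq[of c E T Y e] T Y P(2) unfolding U_def by auto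
      then show ?thesis using one_red_triangle_blue[OF Y] True unfolding X_def by blast
    next
      case False
      then have "e \<in> X" using T unfolding X_def by (cases "c e") auto
      then show ?thesis using T by blast
    qed
  qed
  moreover have "card X \<le> 2 * card U + 3 * card (P - U)"
    unfolding X_def using P(1,2) U card_one_red_triangle[of _ E c]
    by (intro order_trans[OF card_Un_le] add_mono card_UN_le_mult) (auto simp: subset_iff)
  ultimately have "tau E ?F \<le> 2 * card U + 3 * card (P - U)" by (rule tau_le)
  moreover have "card (P - U) = card P - card U" "card U \<le> card P"
    using U P(1) by (auto simp: card_Diff_subset card_mono)
  ultimately show ?thesis unfolding U_def by linarith
qed

text \<open>The blue edges of \<open>P\<close>, at most two per member, hit every triangle outside
  the family that remains after their deletion.\<close>

lemma tau_le_delete_blue: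
  assumes "finite E" "maximum_packing (one_red_triangles E c) P"
  shows "tau E (one_red_triangles E c) 
    \<le> 2 * card P + tau (E - blue_edges c P) (one_red_triangles (E - blue_edges c P) c)"
proof -
  let ?B = "blue_edges c P"
  note P = maximum_packing_facts[OF assms]
  obtain X where X: "transversal (E - ?B) (one_red_triangles (E - ?B) c) X" 
     "card X = tau (E - ?B) (one_red_triangles (E - ?B) c)"
    using tau_attained[OF one_red_triangles_subset_triangles] by blast
  have B: "?B = (\<Union>T\<in>P. {e\<in>T. c e = Blue})" unfolding blue_edges_def by blast
  have "?B \<subseteq> E" using P(2) one_red_triangles_subset_triangles[of E c] 
    unfolding blue_edges_def triangles_def by blast
  then have "transversal E (one_red_triangles E c) (?B \<union> X)"
    using X(1) unfolding transversal_def one_red_triangles_Diff by blast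
  moreover have "card (?B \<union> X) \<le> 2 * card P + card X"
    unfolding B using P(1,2) card_one_red_triangle[of _ E c]
    by (intro order_trans[OF card_Un_le] add_mono card_UN_le_mult) (auto simp: subset_iff)
  ultimately show ?thesis using X(2) tau_le by metis
qed

section \<open>Pairing \<open>Q\<close> with members of \<open>P\<close> and exchanging them\<close>

lemma maximum_packing_partners:
  assumes "finite E" "maximum_packing (one_red_triangles E c) P"
    and "maximum_packing (one_red_triangles (E - blue_edges c P) c) Q"
  obtains f where "f ` Q \<subseteq> P" "inj_on f Q" 
    "\<And>S. S \<in> Q \<Longrightarrow> \<exists>r. r \<in> S \<and> r \<in> f S \<and> c r = Red"
    "\<And>S. S \<in> Q \<Longrightarrow> f S \<noteq> S"
    "\<And>S. S \<in> Q \<Longrightarrow> \<not> red_private c (one_red_triangles E c) (f S)"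
proof -
  let ?F = "one_red_triangles E c" let ?F' = "one_red_triangles (E - blue_edges c P) c"
  note P = maximum_packing_facts[OF assms(1,2)]
  note Q = maximum_packing_facts[OF finite_Diff[OF assms(1)] assms(3)]
  have F': "?F' \<subseteq> ?F" unfolding one_red_triangles_Diff by blast
  \<comment> \<open>By maximality \<open>S\<close> meets \<open>P\<close>, and it avoids all blue
    edges of \<open>P\<close>, so the common edge is red.\<close>
  have "\<exists>T\<in>P. \<exists>r. r \<in> S \<and> r \<in> T \<and> c r = Red" if S: "S \<in> Q" for S
  proof -
    have "S \<in> ?F" "S \<inter> blue_edges c P = {}" using Q(2) S unfolding one_red_triangles_Diff by auto
    then obtain T e where T: "T \<in> P" "e \<in> T" "e \<in> S" using P(4) by blast
    then have "c e = Red" using \<open>S \<inter> blue_edges c P = {}\<close> unfolding blue_edges_def by (cases "c e") auto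
    then show ?thesis using T by blast
  qed
  then obtain f where f: "\<And>S. S \<in> Q \<Longrightarrow> f S \<in> P" 
    "\<And>S. S \<in> Q \<Longrightarrow> \<exists>r. r \<in> S \<and> r \<in> f S \<and> c r = Red"
    by metis
  have ne: "f S \<noteq> S" if "S \<in> Q" for S
  proof
    assume "f S = S"
    then have "S \<in> P" using f(1)[OF that] by simp
    then have "{e\<in>S. c e = Blue} \<subseteq> blue_edges c P" unfolding blue_edges_def by blast
    moreover have "S \<inter> blue_edges c P = {}" "S \<in> ?F'" using Q(2) that unfolding one_red_triangles_Diff by auto
    ultimately show False using one_red_triangle_blue[of S "E - blue_edges c P" c] by blast
  qed
  have "inj_on f Q"
  proof (rule inj_onI)
    fix S S' assume S: "S \<in> Q" "S' \<in> Q" "f S = f S'"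
    obtain r r' where r: "r \<in> S" "r \<in> f S" "c r = Red" "r' \<in> S'" "r' \<in> f S'" "c r' = Red"
      using f(2) S by metis
    \<comment> \<open>Two members of \<open>Q\<close> with the same partner would share its only red
      edge, although \<open>Q\<close> is a packing.\<close>
    have "r = r'" using one_red_triangle_red_unique[of "f S" E c r r'] r S f(1) P(2) by auto
    then show "S = S'" using Q(3) r S unfolding pairwise_def disjnt_def by blast
  qed
  moreover have "\<not> red_private c ?F (f S)" if S: "S \<in> Q" for S
    using red_private_eq[of c E "f S" S] f[OF S] ne[OF S] P(2) F' Q(2) S by blast
  ultimately show ?thesis using that[of f] f ne by blast
qed

lemma tau_le_exchange:
  assumes "finite E" "maximum_packing (one_red_triangles E c) P"
    and "maximum_packing (one_red_triangles (E - blue_edges c P) c) Q"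
  shows "tau E (one_red_triangles E c) + card {T \<in> P. red_private c (one_red_triangles E c) T} 
    + 2 * card Q \<le>
     3 * card P + card {S \<in> Q. red_private c (one_red_triangles (E - blue_edges c P) c) S}"
proof -
  let ?F = "one_red_triangles E c" and ?F' = "one_red_triangles (E - blue_edges c P) c"
  note P = maximum_packing_facts[OF assms(1,2)]
  note Q = maximum_packing_facts[OF finite_Diff[OF assms(1)] assms(3)]
  have F': "?F' \<subseteq> ?F" "\<And>S T e. S \<in> ?F' \<Longrightarrow> T \<in> P \<Longrightarrow> e \<in> S \<Longrightarrow> e \<in> T \<Longrightarrow> c e = Red"
    unfolding one_red_triangles_Diff blue_edges_def using colour.exhaust by blast+
  obtain f where f: "f ` Q \<subseteq> P" "inj_on f Q" 
    "\<And>S. S \<in> Q \<Longrightarrow> \<exists>r. r \<in> S \<and> r \<in> f S \<and> c r = Red"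
    "\<And>S. S \<in> Q \<Longrightarrow> f S \<noteq> S"
    "\<And>S. S \<in> Q \<Longrightarrow> \<not> red_private c ?F (f S)"
    using maximum_packing_partners[OF assms] by metis
  define U where "U = {T \<in> P. red_private c ?F T}"
  define U' where "U' = {S \<in> Q. red_private c ?F' S}"
  \<comment> \<open>\<open>ext S\<close> joins the two vertices opposite the red edge shared by
    \<open>S\<close> and \<open>f S\<close>; it need not be an edge of the graph.\<close>
  define ext where "ext S = (\<Union>(f S) \<union> \<Union>S) - (\<Union>(f S) \<inter> \<Union>S)" for S
  \<comment> \<open>A pair \<open>S\<close>, \<open>f S\<close> contributes its common red edge, and
    also \<open>ext S\<close> when the red edge of \<open>S\<close> is private in
    \<open>?F'\<close>. Unpaired members of \<open>P\<close> contribute as in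
    \<open>tau_le_private\<close>.\<close>
  define W where "W = (\<Union>T\<in>U. {e\<in>T. c e = Blue}) \<union> (\<Union>T\<in>P-U-f ` Q. T) 
    \<union> (\<Union>S\<in>Q. {e\<in>S. c e = Red}) \<union> ext ` U'"
  have fin: "finite U" "finite U'" "U \<subseteq> P" using P(1) Q(1) unfolding U_def U'_def by auto
  have hit: "W \<inter> Y \<noteq> {}" if Y: "Y \<in> ?F" for Y
  proof (rule ccontr)
    assume "\<not> ?thesis"
    then have W: "e \<notin> W" if "e \<in> Y" for e using that by blast
    have rest: "Y \<inter> T = {}" if T: "T \<in> P - f ` Q" for T
    proof (rule ccontr)
      assume "Y \<inter> T \<noteq> {}"
      then obtain e where e: "e \<in> Y" "e \<in> T" by blast
      then have "T \<in> U" "c e = Red" using T W[OF e(1)] unfolding W_def by (auto intro: colour.exhaust)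
      then have "Y = T" using red_private_eq[of c E T Y e] e T Y P(2) unfolding U_def by auto
      then have "{e\<in>Y. c e = Blue} \<subseteq> W" using \<open>T \<in> U\<close> unfolding W_def by blast
      then show False using one_red_triangle_blue[OF Y] W by blast
    qed
    \<comment> \<open>A red edge of \<open>S\<close> or \<open>f S\<close> is the one they share,
      which belongs to \<open>W\<close>.\<close>
    have blue: "c e = Blue" if "S \<in> Q" "e \<in> Y" "e \<in> S \<or> e \<in> f S" for S e
    proof (rule ccontr)
      assume "c e \<noteq> Blue"
      then have "c e = Red" by (cases "c e") auto
      moreover obtain r where "r \<in> S" "r \<in> f S" "c r = Red" using f(3)[OF \<open>S \<in> Q\<close>] by blast
      ultimately have "e \<in> S" 
        using one_red_triangle_red_unique[of "f S" E c e r] that f(1) P(2) by blast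
      then have "e \<in> W" using \<open>c e = Red\<close> that(1) unfolding W_def by blast
      then show False using W that(2) by blast
    qed
    \<comment> \<open>All partners that meet \<open>Y\<close> are exchanged at once. By
      \<open>rest\<close> and the choice of \<open>A\<close>, \<open>Y\<close> avoids what is kept
      of \<open>P\<close>, so it must meet some \<open>S\<close> in \<open>A\<close> as well as
      \<open>f S\<close>.\<close>
    define A where "A = {S \<in> Q. f S \<inter> Y \<noteq> {}}"
    define P' where "P' = (P - f ` A) \<union> A"
    have A: "A \<subseteq> Q" "finite A" using Q(1) unfolding A_def by auto
    \<comment> \<open>A common edge would be the red edge of \<open>S\<close>, which lies in
      \<open>f S\<close>, a member of the packing \<open>P\<close> different from
      \<open>T\<close>.\<close>
    have disj: "disjnt T S" if "T \<in> P - f ` A" "S \<in> A" for T S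
    proof -
      have "e \<notin> T" if e: "e \<in> S" for e
      proof
        assume "e \<in> T"
        have SQ: "S \<in> Q" using \<open>S \<in> A\<close> A by blast
        then have "c e = Red" using F'(2) e \<open>e \<in> T\<close> \<open>T \<in> P - f ` A\<close> Q(2) by blast
        moreover obtain r where "r \<in> S" "r \<in> f S" "c r = Red" using f(3) SQ by blast
        ultimately have "e \<in> f S" using one_red_triangle_red_unique[of S "E - blue_edges c P" c e r] e SQ Q(2) by blast
        moreover have "f S \<in> P" "f S \<noteq> T" using f(1) SQ that \<open>T \<in> P - f ` A\<close> \<open>S \<in> A\<close> by auto
        ultimately show False using P(3) \<open>e \<in> T\<close> \<open>T \<in> P - f ` A\<close> unfolding pairwise_def disjnt_def by blast
      qed
      then show ?thesis unfolding disjnt_def by blast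
    qed
    have "pairwise disjnt P'"
    proof (rule pairwiseI)
      fix T S assume "T \<in> P'" "S \<in> P'" "T \<noteq> S"
      then consider "T \<in> P - f ` A" "S \<in> P - f ` A" | "T \<in> P - f ` A" "S \<in> A"
        | "T \<in> A" "S \<in> P - f ` A" | "T \<in> A" "S \<in> A"
        unfolding P'_def by blast
      then show "disjnt T S"
      proof cases
        case 1
        then show ?thesis using pairwiseD[OF P(3)] \<open>T \<noteq> S\<close> by blast
      next
        case 2
        then show ?thesis by (rule disj)
      next
        case 3
        then show ?thesis using disj disjnt_sym by metis
      next
        case 4
        then show ?thesis using pairwiseD[OF Q(3)] \<open>T \<noteq> S\<close> A(1) by blast
      qed
    qed
    moreover have "P' \<subseteq> ?F" "finite P'" using P(1,2) Q(2) F'(1) A unfolding P'_def by auto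
    moreover have "card P' = card P"
    proof -
      have "(P - f ` A) \<inter> A = {}"
      proof (rule ccontr)
        assume "\<not> ?thesis"
        then obtain S where "S \<in> P - f ` A" "S \<in> A" by blast
        then have "S = {}" using disj by fastforce
        then show False using \<open>S \<in> A\<close> A f(3) by blast
      qed
      moreover have "card (f ` A) = card A" using f(2) A card_image inj_on_subset by metis
      moreover have "f ` A \<subseteq> P" using f(1) A by blast
      ultimately show ?thesis unfolding P'_def using P(1) A
        by (simp add: card_Un_disjoint card_Diff_subset card_mono)
           (metis card_mono le_add_diff_inverse2)
    qed
    moreover have "Y \<noteq> {}" using one_red_triangle_blue[OF Y] by blast
    ultimately obtain T where T: "T \<in> P'" "Y \<inter> T \<noteq> {}"
      using maximum_packing_meets[OF assms(2) P(1), of P' Y] Y by auto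
    then have "T \<in> A" using rest unfolding P'_def A_def by blast
    then obtain S a b where S: "S \<in> Q" and a: "a \<in> f S" "a \<in> Y" and b: "b \<in> S" "b \<in> Y"
      using T(2) unfolding A_def by blast
    have col: "c a = Blue" "c b = Blue" using blue S a b by blast+
    obtain r where r: "r \<in> S" "r \<in> f S" "c r = Red" using f(3) S by blast
    have SF: "S \<in> ?F'" "f S \<in> P" using S Q(2) f(1) by auto
    have "ext S \<in> Y" unfolding ext_def
      by (rule third_edge_between_triangles[of _ E _ E _ E r a b])
        (use S a b r col f(4) Y SF F'(1) P(2) one_red_triangles_subset_triangles[of E c] in auto)
    then have "S \<notin> U'" using W unfolding W_def by blast
    then have "\<not> private_edge ?F' r" using S r unfolding U'_def red_private_def by blast
    then obtain X where X: "X \<in> ?F'" "r \<in> X" "X \<noteq> S"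
      using r SF unfolding private_edge_def by blast
    \<comment> \<open>The blue edge \<open>a\<close> of \<open>P\<close> cannot lie in
      \<open>S\<close>. So \<open>a\<close> and \<open>b\<close> are all the blue edges of
      \<open>Y\<close>.\<close>
    have "a \<noteq> b" using F'(2) SF a b col by force
    have blueY: "e = a \<or> e = b" if "e \<in> Y" "c e = Blue" for e
      by (rule one_red_trianglesE[OF Y]) (use that a(2) b(2) col \<open>a \<noteq> b\<close> in auto)
    \<comment> \<open>Exchanging \<open>f S\<close> for \<open>X\<close> gives another maximum
      packing, which \<open>Y\<close> must meet. This fails: \<open>r\<close> and all red edges of
      paired triangles are in \<open>W\<close>; \<open>a\<close> lies in no member of
      \<open>P\<close> but \<open>f S\<close>, and not in \<open>X\<close>; \<open>b\<close> lies in
      no member of \<open>P\<close>, and \<open>X\<close> containing both \<open>r\<close> and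
      \<open>b\<close> would equal \<open>S\<close>.\<close>
    define P'' where "P'' = insert X (P - {f S})"
    have dX: "disjnt X T" if "T \<in> P - {f S}" for T
    proof -
      have "e \<notin> T" if e: "e \<in> X" for e
      proof
        assume "e \<in> T"
        then have "c e = Red" using F'(2) X e \<open>T \<in> P - {f S}\<close> by blast
        then have "e = r" using one_red_triangle_red_unique[OF X(1)] X(2) e r by blast
        then show False using P(3) r(2) SF(2) \<open>e \<in> T\<close> \<open>T \<in> P - {f S}\<close> unfolding pairwise_def disjnt_def by blast
      qed
      then show ?thesis unfolding disjnt_def by blast
    qed
    have "X \<notin> P - {f S}" using dX X(2) by (fastforce simp: disjnt_def)
    then have "card P'' = card P" unfolding P''_def
      using card_Suc_Diff1[OF P(1) SF(2)] P(1) by simp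
    moreover have "pairwise disjnt P''" 
      using P(3) dX disjnt_sym unfolding P''_def pairwise_insert
      by (auto intro: pairwise_mono)
    moreover have "P'' \<subseteq> ?F" "finite P''" using P(1,2) X F'(1) unfolding P''_def by auto
    ultimately obtain T e where T: "T \<in> P''" "e \<in> Y" "e \<in> T"
      using maximum_packing_meets[OF assms(2) P(1), of P'' Y] Y \<open>Y \<noteq> {}\<close> by auto
    show False
    proof (cases "T = X")
      case True
      have "e \<noteq> r" using T(2) W r S unfolding W_def by blast
      then have "c e \<noteq> Red" using one_red_triangle_red_unique[OF X(1)] T True X(2) r by blast
      then have "e = a \<or> e = b" using blueY T by (cases "c e") auto
      moreover have "e \<noteq> a" using F'(2)[OF X(1) SF(2)] T True a col by force
      moreover have "e \<noteq> b"
        using triangles_eqI[of X E S E e r] T True X SF b r \<open>e \<noteq> r\<close> F'(1)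
          one_red_triangles_subset_triangles[of E c] by blast
      ultimately show False by blast
    next
      case False
      then have TP: "T \<in> P" "T \<noteq> f S" using T unfolding P''_def by auto
      then have "T \<in> f ` Q" using rest T by blast
      then have "c e = Blue" using blue T by blast
      then have "e = a \<or> e = b" using blueY T by blast
      moreover have "e \<noteq> a" using P(3) TP T(3) a SF(2) unfolding pairwise_def disjnt_def by blast
      moreover have "e \<noteq> b" using F'(2)[OF SF(1) TP(1)] T b col by force
      ultimately show False by blast
    qed
  qed
  \<comment> \<open>Intersecting with \<open>E\<close> discards those \<open>ext S\<close> that are
    not edges of the graph.\<close>
  have "transversal E ?F (W \<inter> E)"
    using hit one_red_triangles_subset_triangles[of E c]
    unfolding transversal_def triangles_def by blast
  moreover have "card (W \<inter> E) \<le> 2 * card U + 3 * card (P - U - f ` Q) + 1 * card Q + card U'"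
  proof -
    have "finite T" if "T \<in> P \<or> T \<in> Q" for T
      using that P(2) Q(2) card_one_red_triangle(1) by blast
    then have "finite W"
      unfolding W_def using fin P(1) Q(1) by (intro finite_UnI finite_UN_I finite_imageI) auto
    then have "card (W \<inter> E) \<le> card W" by (simp add: card_mono)
    also have "\<dots> \<le> 2 * card U + 3 * card (P - U - f ` Q) + 1 * card Q + card U'"
      unfolding W_def using P(1,2) Q(1,2) fin card_one_red_triangle[of _ E c]
        card_one_red_triangle[of _ "E - blue_edges c P" c]
      by (intro order_trans[OF card_Un_le] add_mono card_UN_le_mult card_image_le) 
         (auto simp: subset_iff)
    finally show ?thesis .
  qed
  ultimately have "tau E ?F \<le> 2 * card U + 3 * card (P - U - f ` Q) + 1 * card Q + card U'"
    by (rule tau_le)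
  \<comment> \<open>Partners never have a private red edge, so \<open>U\<close> and the image of
    \<open>f\<close> are disjoint, and \<open>f\<close> is injective.\<close>
  moreover have "card (P - U - f ` Q) + card Q + card U = card P"
  proof -
    have sub: "U \<union> f ` Q \<subseteq> P" "U \<inter> f ` Q = {}" using f(1,5) unfolding U_def by auto
    have "card (U \<union> f ` Q) = card U + card Q"
      using sub fin Q(1) f(2) by (simp add: card_Un_disjoint card_image)
    moreover have "P - U - f ` Q = P - (U \<union> f ` Q)" by blast
    moreover have "card (P - (U \<union> f ` Q)) + card (U \<union> f ` Q) = card P"
      using sub P(1) finite_subset card_Diff_subset card_mono by (metis le_add_diff_inverse2)
    ultimately show ?thesis by simp
  qed
  ultimately show ?thesis unfolding U_def U'_def by linarith
qed

section \<open>Linear combinations of the bounds\<close>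

lemma tau_le_eight_thirds:
  assumes "finite E" "maximum_packing (one_red_triangles E c) P"
  shows "3 * tau E (one_red_triangles E c) + 2 * card {T \<in> P. red_private c (one_red_triangles E c) T} 
    \<le> 8 * card P"
proof -
  let ?E = "E - blue_edges c P"
  let ?F' = "one_red_triangles ?E c"
  obtain Q where Q: "maximum_packing ?F' Q"
    using maximum_packing_exists finite_one_red_triangles finite_Diff[OF assms(1)] by metis
  have "finite ?E" using assms by simp
  \<comment> \<open>Applying \<open>tau_le_private\<close> to \<open>Q\<close> in the reduced graph
    bounds the second term of \<open>tau_le_delete_blue\<close>. The weighted sum leaves a surplus
    \<open>u' - q\<close>, which is at most zero because \<open>u'\<close> counts members of
    \<open>Q\<close>.\<close>
  from tau_le_private[OF this Q] maximum_packing_facts(1)[OF this Q]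
    tau_le_delete_blue[OF assms] tau_le_exchange[OF assms Q]
  show ?thesis using card_mono[of Q "{S \<in> Q. red_private c ?F' S}"] by auto
qed

theorem lemma2p3:
  fixes V :: "'a set" and E :: "'a set set" and c :: "'a set \<Rightarrow> colour"
    and P Q :: "'a set set set" and p q u :: nat
  assumes "simple_graph V E"
    and "maximum_packing (one_red_triangles E c) P"
    and "maximum_packing (one_red_triangles (E - blue_edges c P) c) Q"
    and "p = card P"
    and "q = card Q"
    and "u = card {T \<in> P. \<exists>e\<in>T. c e = Red \<and> private_edge (one_red_triangles E c) e}"
  shows "real (tau E (one_red_triangles E c)) \<le> 8 / 3 * real p - 2 / 3 * real u \<and>
         real (tau E (one_red_triangles E c)) \<le> 9 / 4 * real p + 3 / 2 * real q - 1 / 4 * real u"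
proof -
  let ?E = "E - blue_edges c P"
  have fin: "finite E" "finite ?E" using finite_edges[OF assms(1)] by auto
  have u: "u = card {T \<in> P. red_private c (one_red_triangles E c) T}"
    unfolding assms(6) red_private_def ..
  have "card {S \<in> Q. red_private c (one_red_triangles ?E c) S} \<le> card Q"
    using maximum_packing_facts(1)[OF fin(2) assms(3)] by (simp add: card_mono)
  \<comment> \<open>With \<open>u'\<close> the cardinality bounded just above, the second inequality
    is the sum of \<open>tau_le_exchange\<close> and three times \<open>tau_le_delete_blue\<close>,
    where three times the remaining \<open>tau\<close> is at most
    \<open>8 * q - 2 * u'\<close>.\<close>
  with tau_le_eight_thirds[OF fin(1) assms(2)] tau_le_eight_thirds[OF fin(2) assms(3)]
    tau_le_delete_blue[OF fin(1) assms(2)] tau_le_exchange[OF fin(1) assms(2,3)]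
  show ?thesis unfolding assms(4,5) u by linarith
qed

end
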